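(* Let $n \geq 3$. If $G$ is a group that has no subgroup isomorphic to $\mathbb{Z}^{n-1}$, then every homomorphism $\mathrm{Aut}(F_n) \to G$ factors through the quotient map $\mathrm{Aut}(F_n) \to Q_{n,m}$ for some integer $m \geq 1$.
   Context: $F_n$ is the free group with a fixed basis $\{a_1, \dots, a_n\}$. For $i \neq j$, $\lambda_{ij} \in \mathrm{Aut}(F_n)$ is the automorphism that sends $a_i$ to $a_j a_i$ and fixes $a_k$ for all $k \neq i$. $Q_{n,m}$ is the quotient of $\mathrm{Aut}(F_n)$ by the relations $\lambda_{ij}^m = 1$ for all $i \neq j$, i.e. the quotient by the normal closure of $\{\lambda_{ij}^m : i \neq j\}$. *)

theory Defs
  imports "HOL-Algebra.Bij" "HOL-Algebra.Product_Groups"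
begin

text \<open>
  The free group on \<open>a_1, ..., a_n\<close> is modelled by reduced words. The letter \<open>(k, True)\<close>
  stands for \<open>a_k\<close> and \<open>(k, False)\<close> for its inverse.
\<close>

type_synonym letter = "nat \<times> bool"

definition inv_letter :: "letter \<Rightarrow> letter" where
  "inv_letter x = (fst x, \<not> snd x)"

definition reduced :: "letter list \<Rightarrow> bool" where
  "reduced w \<longleftrightarrow> successively (\<lambda>x y. y \<noteq> inv_letter x) w"

fun push_letter :: "letter \<Rightarrow> letter list \<Rightarrow> letter list" where
  "push_letter x [] = [x]"
| "push_letter x (y # w) = (if y = inv_letter x then w else x # y # w)"

definition free_group :: "nat \<Rightarrow> letter list monoid" where
  "free_group n =
     \<lparr>carrier = {w. set w \<subseteq> {1..n} \<times> UNIV \<and> reduced w},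
      mult = (\<lambda>u v. foldr push_letter u v),
      one = []\<rparr>"

definition free_gen :: "nat \<Rightarrow> letter list" where
  "free_gen k = [(k, True)]"

text \<open>
  The homomorphism from the free group to \<open>H\<close> that sends each \<open>a_k\<close> to \<open>f k\<close>; see
  \<open>word_eval_hom\<close>, \<open>word_eval_gen\<close> and \<open>free_group_hom_unique\<close> below.
\<close>

definition word_eval :: "('g, 'b) monoid_scheme \<Rightarrow> (nat \<Rightarrow> 'g) \<Rightarrow> letter list \<Rightarrow> 'g" where
  "word_eval H f w =
     foldr (\<lambda>x g. (if snd x then f (fst x) else inv\<^bsub>H\<^esub> (f (fst x))) \<otimes>\<^bsub>H\<^esub> g) w \<one>\<^bsub>H\<^esub>"

definition aut_free_group :: "nat \<Rightarrow> (letter list \<Rightarrow> letter list) monoid" where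
  "aut_free_group n = AutoGroup (free_group n)"

text \<open>
  The automorphism \<open>\<lambda>_ij\<close>, sending \<open>a_i\<close> to \<open>a_j a_i\<close> and fixing the other basis elements. It is
  restricted to the carrier because the elements of \<open>AutoGroup\<close> are extensional functions.
\<close>

definition transvection :: "nat \<Rightarrow> nat \<Rightarrow> nat \<Rightarrow> letter list \<Rightarrow> letter list" where
  "transvection n i j =
     (\<lambda>w \<in> carrier (free_group n).
        word_eval (free_group n)
          (\<lambda>k. if k = i then free_gen j \<otimes>\<^bsub>free_group n\<^esub> free_gen i else free_gen k) w)"

definition normal_closure :: "('g, 'b) monoid_scheme \<Rightarrow> 'g set \<Rightarrow> 'g set" where
  "normal_closure G S = \<Inter> {N. N \<lhd> G \<and> S \<subseteq> N}"

definition transvection_powers :: "nat \<Rightarrow> nat \<Rightarrow> (letter list \<Rightarrow> letter list) set" where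
  "transvection_powers n m =
     {transvection n i j [^]\<^bsub>aut_free_group n\<^esub> m | i j. i \<in> {1..n} \<and> j \<in> {1..n} \<and> i \<noteq> j}"

definition transvection_kernel :: "nat \<Rightarrow> nat \<Rightarrow> (letter list \<Rightarrow> letter list) set" where
  "transvection_kernel n m = normal_closure (aut_free_group n) (transvection_powers n m)"

definition Q_group :: "nat \<Rightarrow> nat \<Rightarrow> (letter list \<Rightarrow> letter list) set monoid" where
  "Q_group n m = aut_free_group n Mod transvection_kernel n m"

definition Q_proj :: "nat \<Rightarrow> nat \<Rightarrow> (letter list \<Rightarrow> letter list) \<Rightarrow> (letter list \<Rightarrow> letter list) set" where
  "Q_proj n m \<phi> = transvection_kernel n m #>\<^bsub>aut_free_group n\<^esub> \<phi>"

definition free_abelian_power :: "nat \<Rightarrow> (nat \<Rightarrow> int) monoid" where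
  "free_abelian_power k = product_group {..<k} (\<lambda>_. integer_group)"

lemma inv_letter_inv_letter [simp]: "inv_letter (inv_letter x) = x"
  by (simp add: inv_letter_def)

lemma inv_letter_neq [simp]: "inv_letter x \<noteq> x" "x \<noteq> inv_letter x"
  by (auto simp: inv_letter_def prod_eq_iff)

lemma inv_letter_eq_iff: "inv_letter x = y \<longleftrightarrow> x = inv_letter y"
  by auto

lemma inv_letter_in [simp]: "inv_letter x \<in> A \<times> UNIV \<longleftrightarrow> x \<in> A \<times> UNIV"
  by (cases x) (auto simp: inv_letter_def)

lemma reduced_Cons: "reduced (x # w) \<longleftrightarrow> reduced w \<and> (w = [] \<or> hd w \<noteq> inv_letter x)"
  by (cases w) (auto simp: reduced_def)

lemma reduced_Nil [simp]: "reduced []"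
  by (simp add: reduced_def)

lemma reduced_push: "reduced w \<Longrightarrow> reduced (push_letter x w)"
  by (cases w) (auto simp: reduced_Cons)

lemma push_inv_push: "reduced w \<Longrightarrow> push_letter x (push_letter (inv_letter x) w) = w"
proof (cases w)
  case (Cons y v)
  assume "reduced w"
  then show ?thesis
    using Cons by (cases v) (auto simp: reduced_Cons)
qed auto

lemma set_push: "set (push_letter x w) \<subseteq> insert x (set w)"
  by (cases w) auto

lemma free_carrier_Cons:
  "x # w \<in> carrier (free_group n) \<longleftrightarrow>
     x \<in> {1..n} \<times> UNIV \<and> w \<in> carrier (free_group n) \<and> (w = [] \<or> hd w \<noteq> inv_letter x)"
  by (auto simp: free_group_def reduced_Cons)

lemma free_carrier_reduced: "w \<in> carrier (free_group n) \<Longrightarrow> reduced w"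
  by (simp add: free_group_def)

lemma push_carrier:
  "x \<in> {1..n} \<times> UNIV \<Longrightarrow> w \<in> carrier (free_group n) \<Longrightarrow> push_letter x w \<in> carrier (free_group n)"
  using set_push[of x w] reduced_push[of w x] by (auto simp: free_group_def)

lemma free_mult_simps [simp]:
  "[] \<otimes>\<^bsub>free_group n\<^esub> v = v"
  "(x # u) \<otimes>\<^bsub>free_group n\<^esub> v = push_letter x (u \<otimes>\<^bsub>free_group n\<^esub> v)"
  by (simp_all add: free_group_def)

lemma one_free [simp]: "\<one>\<^bsub>free_group n\<^esub> = []"
  by (simp add: free_group_def)

lemma Nil_free [simp]: "[] \<in> carrier (free_group n)"
  by (simp add: free_group_def)

lemma free_mult_closed:
  "u \<in> carrier (free_group n) \<Longrightarrow> v \<in> carrier (free_group n) \<Longrightarrow>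
     u \<otimes>\<^bsub>free_group n\<^esub> v \<in> carrier (free_group n)"
  by (induction u) (auto simp: free_carrier_Cons simp del: mem_Times_iff intro!: push_carrier)

lemma push_mult:
  assumes "u \<in> carrier (free_group n)" "v \<in> carrier (free_group n)"
  shows "push_letter x u \<otimes>\<^bsub>free_group n\<^esub> v = push_letter x (u \<otimes>\<^bsub>free_group n\<^esub> v)"
proof (cases u)
  case (Cons y w)
  then have "reduced (w \<otimes>\<^bsub>free_group n\<^esub> v)"
    using assms by (auto simp: free_carrier_Cons intro: free_mult_closed free_carrier_reduced)
  then show ?thesis
    using Cons by (auto simp: push_inv_push)
qed auto

lemma group_free_group: "group (free_group n)"
proof (rule groupI)
  fix u v w
  assume "u \<in> carrier (free_group n)" "v \<in> carrier (free_group n)" "w \<in> carrier (free_group n)"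
  then show "u \<otimes>\<^bsub>free_group n\<^esub> v \<otimes>\<^bsub>free_group n\<^esub> w = u \<otimes>\<^bsub>free_group n\<^esub> (v \<otimes>\<^bsub>free_group n\<^esub> w)"
    by (induction u) (auto simp: free_carrier_Cons push_mult free_mult_closed)
next
  fix w assume w: "w \<in> carrier (free_group n)"
  have inv_ex: "\<exists>y \<in> carrier (free_group n). \<forall>v \<in> carrier (free_group n).
      y \<otimes>\<^bsub>free_group n\<^esub> (w \<otimes>\<^bsub>free_group n\<^esub> v) = v"
    using w
  proof (induction w)
    case Nil
    show ?case by (intro bexI[of _ "[]"]) auto
  next
    case (Cons x w)
    then have x: "x \<in> {1..n} \<times> UNIV" and w: "w \<in> carrier (free_group n)"
      by (auto simp: free_carrier_Cons simp del: mem_Times_iff)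
    then obtain y where y: "y \<in> carrier (free_group n)"
      "\<And>v. v \<in> carrier (free_group n) \<Longrightarrow> y \<otimes>\<^bsub>free_group n\<^esub> (w \<otimes>\<^bsub>free_group n\<^esub> v) = v"
      using Cons by blast
    have x': "[inv_letter x] \<in> carrier (free_group n)"
      using x by (simp add: free_carrier_Cons del: mem_Times_iff)
    have assoc: "u \<otimes>\<^bsub>free_group n\<^esub> [inv_letter x] \<otimes>\<^bsub>free_group n\<^esub> v =
        u \<otimes>\<^bsub>free_group n\<^esub> push_letter (inv_letter x) v"
      if "u \<in> carrier (free_group n)" "v \<in> carrier (free_group n)" for u v
      using that x'
      by (induction u) (auto simp: free_carrier_Cons push_mult free_mult_closed simp del: mem_Times_iff)
    show ?case
    proof (rule bexI[of _ "y \<otimes>\<^bsub>free_group n\<^esub> [inv_letter x]"], intro ballI)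
      fix v assume v: "v \<in> carrier (free_group n)"
      have wv: "w \<otimes>\<^bsub>free_group n\<^esub> v \<in> carrier (free_group n)"
        using w v by (rule free_mult_closed)
      show "y \<otimes>\<^bsub>free_group n\<^esub> [inv_letter x] \<otimes>\<^bsub>free_group n\<^esub> ((x # w) \<otimes>\<^bsub>free_group n\<^esub> v) = v"
        using assoc[OF y(1) push_carrier[OF x wv]] y(2)[OF v]
          push_inv_push[OF free_carrier_reduced[OF wv], of "inv_letter x"] by simp
    qed (rule free_mult_closed[OF y(1) x'])
  qed
  have right_one: "u \<otimes>\<^bsub>free_group n\<^esub> [] = u" if "u \<in> carrier (free_group n)" for u
    using that
  proof (induction u)
    case (Cons x u)
    then show ?case by (cases u) (auto simp: free_carrier_Cons)
  qed auto
  show "\<exists>y \<in> carrier (free_group n). y \<otimes>\<^bsub>free_group n\<^esub> w = \<one>\<^bsub>free_group n\<^esub>"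
    using inv_ex right_one[OF w] by (metis Nil_free one_free)
qed (auto intro: free_mult_closed)

lemma free_gen_carrier: "k \<in> {1..n} \<Longrightarrow> free_gen k \<in> carrier (free_group n)"
  by (simp add: free_gen_def free_carrier_Cons)

lemma word_eval_simps [simp]:
  "word_eval H f [] = \<one>\<^bsub>H\<^esub>"
  "word_eval H f (x # w) =
     (if snd x then f (fst x) else inv\<^bsub>H\<^esub> (f (fst x))) \<otimes>\<^bsub>H\<^esub> word_eval H f w"
  by (simp_all add: word_eval_def)

context
  fixes H :: "('g, 'b) monoid_scheme" (structure) and f :: "nat \<Rightarrow> 'g" and n :: nat
  assumes H: "group H" and f: "f \<in> {1..n} \<rightarrow> carrier H"
begin

interpretation H: group H by (rule H)

lemma word_eval_closed: "w \<in> carrier (free_group n) \<Longrightarrow> word_eval H f w \<in> carrier H"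
  using f by (induction w) (auto simp: free_carrier_Cons Pi_iff)

lemma word_eval_gen: "k \<in> {1..n} \<Longrightarrow> word_eval H f (free_gen k) = f k"
  using f by (auto simp: free_gen_def Pi_iff)

lemma word_eval_push:
  assumes "x \<in> {1..n} \<times> UNIV" "w \<in> carrier (free_group n)"
  shows "word_eval H f (push_letter x w) = word_eval H f (x # w)"
proof (cases w)
  case (Cons y v)
  have "f (fst x) \<in> carrier H" using assms(1) f by auto
  moreover have "word_eval H f v \<in> carrier H"
    using assms(2) Cons by (auto simp: free_carrier_Cons intro: word_eval_closed)
  ultimately show ?thesis
    using Cons by (auto simp: inv_letter_def H.m_assoc[symmetric])
qed auto

lemma word_eval_hom: "word_eval H f \<in> hom (free_group n) H"
proof (rule homI)
  fix u v assume uv: "u \<in> carrier (free_group n)" "v \<in> carrier (free_group n)"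
  then show "word_eval H f (u \<otimes>\<^bsub>free_group n\<^esub> v) = word_eval H f u \<otimes> word_eval H f v"
  proof (induction u)
    case (Cons x u)
    then have x: "x \<in> {1..n} \<times> UNIV" and u: "u \<in> carrier (free_group n)"
      by (auto simp: free_carrier_Cons simp del: mem_Times_iff)
    have "f (fst x) \<in> carrier H" using x f by auto
    then show ?case
      using Cons u by (simp add: word_eval_push[OF x] free_mult_closed word_eval_closed H.m_assoc)
  qed (simp add: word_eval_closed)
qed (rule word_eval_closed)

lemma free_group_hom_unique:
  assumes h: "h \<in> hom (free_group n) H" and hf: "\<And>k. k \<in> {1..n} \<Longrightarrow> h (free_gen k) = f k"
    and w: "w \<in> carrier (free_group n)"
  shows "h w = word_eval H f w"
proof -
  interpret h: group_hom "free_group n" H h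
    using h H group_free_group by (simp add: group_hom_def group_hom_axioms_def)
  show ?thesis
    using w
  proof (induction w)
    case Nil
    show ?case using h.hom_one by simp
  next
    case (Cons x w)
    then have x: "fst x \<in> {1..n}" and w: "w \<in> carrier (free_group n)"
      by (auto simp: free_carrier_Cons)
    have x': "[x] \<in> carrier (free_group n)"
      using x by (cases x) (simp add: free_carrier_Cons)
    have "h [x] = (if snd x then f (fst x) else inv (f (fst x)))"
    proof (cases "snd x")
      case True
      then show ?thesis using hf[OF x] by (simp add: free_gen_def) (metis prod.collapse)
    next
      case False
      have gen: "[x] \<otimes>\<^bsub>free_group n\<^esub> free_gen (fst x) = \<one>\<^bsub>free_group n\<^esub>"
        using False by (simp add: free_gen_def inv_letter_def)
      have "h [x] \<otimes> h (free_gen (fst x)) = \<one>"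
        by (metis gen h.hom_mult h.hom_one x' free_gen_carrier[OF x])
      then show ?thesis
        using False hf[OF x] H.inv_equality[of "h [x]" "f (fst x)"] f x h.hom_closed[OF x']
          by (auto simp: Pi_iff)
    qed
    moreover
    have split: "x # w = [x] \<otimes>\<^bsub>free_group n\<^esub> w"
      using Cons.prems by (cases w) (auto simp: free_carrier_Cons)
    have "h (x # w) = h [x] \<otimes> h w"
      unfolding split by (rule h.hom_mult[OF x' w])
    ultimately show ?case
      using Cons.IH[OF w] by (simp only: word_eval_simps)
  qed
qed

end

lemma transvection_hom:
  assumes "i \<in> {1..n}" "j \<in> {1..n}"
  shows "transvection n i j \<in> hom (free_group n) (free_group n)"
    and "\<And>k. k \<in> {1..n} \<Longrightarrow> transvection n i j (free_gen k) =
           (if k = i then free_gen j \<otimes>\<^bsub>free_group n\<^esub> free_gen i else free_gen k)"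
proof -
  let ?F = "free_group n"
  let ?f = "\<lambda>k. if k = i then free_gen j \<otimes>\<^bsub>?F\<^esub> free_gen i else free_gen k"
  have f: "?f \<in> {1..n} \<rightarrow> carrier ?F"
    using assms by (auto intro!: free_mult_closed free_gen_carrier)
  show "transvection n i j \<in> hom ?F ?F"
    using word_eval_hom[OF group_free_group f]
    by (auto simp: transvection_def hom_def free_mult_closed)
  show "transvection n i j (free_gen k) = ?f k" if "k \<in> {1..n}" for k
    using word_eval_gen[OF group_free_group f that] free_gen_carrier[OF that]
    by (simp add: transvection_def)
qed

lemma transvection_in_aut:
  assumes ij: "i \<in> {1..n}" "j \<in> {1..n}" "i \<noteq> j"
  shows "transvection n i j \<in> carrier (aut_free_group n)"
proof -
  let ?F = "free_group n" and ?t = "transvection n i j"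
  interpret F: group ?F by (rule group_free_group)
  note gens = free_gen_carrier[OF ij(1)] free_gen_carrier[OF ij(2)]
  let ?g = "\<lambda>k. if k = i then inv\<^bsub>?F\<^esub> free_gen j \<otimes>\<^bsub>?F\<^esub> free_gen i else free_gen k"
  let ?s = "word_eval ?F ?g"
  have g: "?g \<in> {1..n} \<rightarrow> carrier ?F"
    using gens by (auto intro!: free_gen_carrier)
  have s: "?s \<in> hom ?F ?F" "\<And>k. k \<in> {1..n} \<Longrightarrow> ?s (free_gen k) = ?g k"
    by (rule word_eval_hom[OF group_free_group g], rule word_eval_gen[OF group_free_group g])
  note t = transvection_hom[OF ij(1,2)]
  interpret s: group_hom ?F ?F ?s
    using s(1) group_free_group by (simp add: group_hom_def group_hom_axioms_def)
  interpret t: group_hom ?F ?F ?t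
    using t(1) group_free_group by (simp add: group_hom_def group_hom_axioms_def)
  have id: "h w = w"
    if "h \<in> hom ?F ?F" "\<And>k. k \<in> {1..n} \<Longrightarrow> h (free_gen k) = free_gen k" "w \<in> carrier ?F" for h w
  proof -
    have free_gen: "free_gen \<in> {1..n} \<rightarrow> carrier ?F" by (auto intro: free_gen_carrier)
    have "(\<lambda>w. w) \<in> hom ?F ?F" by (simp add: hom_def)
    then show ?thesis
      using free_group_hom_unique[OF group_free_group free_gen that]
        free_group_hom_unique[OF group_free_group free_gen, of "\<lambda>w. w" w] that(3) by simp
  qed
  have st: "?s (?t w) = w" if "w \<in> carrier ?F" for w
  proof -
    have h: "?s \<circ> ?t \<in> hom ?F ?F" using t(1) s(1) by (rule hom_compose)
    have "(?s \<circ> ?t) (free_gen k) = free_gen k" if "k \<in> {1..n}" for k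
      using t(2)[OF that] s(2)[OF that] s(2)[OF ij(2)] gens ij(3)
      by (auto simp del: free_mult_simps simp: F.m_assoc[symmetric])
    from id[OF h this that] show ?thesis by simp
  qed
  have ts: "?t (?s w) = w" if "w \<in> carrier ?F" for w
  proof -
    have h: "?t \<circ> ?s \<in> hom ?F ?F" using s(1) t(1) by (rule hom_compose)
    have "(?t \<circ> ?s) (free_gen k) = free_gen k" if "k \<in> {1..n}" for k
      using s(2)[OF that] t(2)[OF that] t(2)[OF ij(2)] gens ij(3)
      by (auto simp del: free_mult_simps one_free simp: F.m_assoc[symmetric])
    from id[OF h this that] show ?thesis by simp
  qed
  have "bij_betw ?t (carrier ?F) (carrier ?F)"
    by (rule bij_betwI[where g = ?s]) (auto simp: st ts)
  then show ?thesis
    using t(1) by (simp add: aut_free_group_def AutoGroup_def auto_def Bij_def transvection_def)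
qed

lemma group_aut_free_group: "group (aut_free_group n)"
  unfolding aut_free_group_def by (rule group.AutoGroup[OF group_free_group])

lemma (in group) normal_closure_normal:
  assumes "S \<subseteq> carrier G"
  shows "normal_closure G S \<lhd> G"
proof -
  have carrier: "carrier G \<lhd> G"
    by (simp add: normal_inv_iff subgroup_self)
  have "subgroup (normal_closure G S) G"
    unfolding normal_closure_def
    by (rule subgroups_Inter) (use carrier assms in \<open>auto simp: normal_inv_iff\<close>)
  then show ?thesis
    by (auto simp: normal_inv_iff normal_closure_def)
qed

lemma transvection_powers_carrier: "transvection_powers n m \<subseteq> carrier (aut_free_group n)"
proof -
  interpret group "aut_free_group n" by (rule group_aut_free_group)
  show ?thesis by (auto simp: transvection_powers_def intro!: nat_pow_closed transvection_in_aut)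
qed

lemma transvection_kernel_normal: "transvection_kernel n m \<lhd> aut_free_group n"
  unfolding transvection_kernel_def
  by (rule group.normal_closure_normal[OF group_aut_free_group transvection_powers_carrier])

end

theory Submission
  imports Defs
begin

text \<open>
  For fixed \<open>j\<close> the \<open>\<lambda>_ij\<close> generate a free abelian group of rank \<open>n - 1\<close>, whose elements are the
  shears \<open>a_i \<mapsto> a_j^{f i} a_i\<close>. By hypothesis \<open>\<phi>\<close> is not injective on it, so its kernel contains a
  shear \<open>t\<close> with some \<open>f s \<noteq> 0\<close>. For \<open>r\<close> different from \<open>s\<close> and \<open>j\<close>, conjugating \<open>t\<close> by the inversion
  of \<open>a_r\<close> and taking a commutator with \<open>\<lambda>_rs\<close> isolates \<open>\<lambda>_rj\<close> to the power \<open>f s\<close> in the kernel.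
  The same step applied to this power in place of \<open>t\<close>, with the roles of \<open>r\<close> and \<open>s\<close> exchanged,
  reaches \<open>\<lambda>_sj\<close>. The product over \<open>j\<close> of the exponents obtained serves as \<open>m\<close>.
\<close>

text \<open>From here on products are computed by the group laws; rewriting the unit to
  \<open>[]\<close> would hide it from them.\<close>

declare free_mult_simps [simp del] one_free [simp del]

definition free_endo :: "nat \<Rightarrow> (nat \<Rightarrow> letter list) \<Rightarrow> letter list \<Rightarrow> letter list" where
  "free_endo n f = (\<lambda>w \<in> carrier (free_group n). word_eval (free_group n) f w)"

definition shear :: "nat \<Rightarrow> nat \<Rightarrow> (nat \<Rightarrow> int) \<Rightarrow> letter list \<Rightarrow> letter list" where
  "shear n j f = free_endo n (\<lambda>k. if k = j then free_gen j
     else (free_gen j [^]\<^bsub>free_group n\<^esub> f k) \<otimes>\<^bsub>free_group n\<^esub> free_gen k)"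

definition gen_inversion :: "nat \<Rightarrow> nat \<Rightarrow> letter list \<Rightarrow> letter list" where
  "gen_inversion n r = free_endo n (\<lambda>k. if k = r then inv\<^bsub>free_group n\<^esub> free_gen k else free_gen k)"

context
  fixes n :: nat
begin

private abbreviation (input) "F \<equiv> free_group n"
private abbreviation (input) "A \<equiv> aut_free_group n"

interpretation F: group F by (rule group_free_group)
interpretation A: group A by (rule group_aut_free_group)

section \<open>Automorphisms determined by their values on the basis\<close>

lemma aut_carrier: "carrier A = hom F F \<inter> Bij (carrier F)"
  by (simp add: aut_free_group_def AutoGroup_def auto_def)

lemma aut_group_hom: "\<alpha> \<in> carrier A \<Longrightarrow> group_hom F F \<alpha>"
  by (simp add: aut_carrier group_hom_def group_hom_axioms_def group_free_group)

lemma aut_mult_apply: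
  "\<alpha> \<in> carrier A \<Longrightarrow> \<beta> \<in> carrier A \<Longrightarrow> w \<in> carrier F \<Longrightarrow> (\<alpha> \<otimes>\<^bsub>A\<^esub> \<beta>) w = \<alpha> (\<beta> w)"
  by (auto simp: aut_free_group_def AutoGroup_def auto_def BijGroup_def compose_def)

lemma aut_one_apply: "w \<in> carrier F \<Longrightarrow> \<one>\<^bsub>A\<^esub> w = w"
  by (simp add: aut_free_group_def AutoGroup_def BijGroup_def)

lemma hom_eq_on_gens:
  assumes "g \<in> hom F F" "h \<in> hom F F" "\<And>k. k \<in> {1..n} \<Longrightarrow> g (free_gen k) = h (free_gen k)"
    and "w \<in> carrier F"
  shows "g w = h w"
proof -
  have "(\<lambda>k. h (free_gen k)) \<in> {1..n} \<rightarrow> carrier F"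
    using assms(2) by (auto simp: hom_def free_gen_carrier)
  from free_group_hom_unique[OF group_free_group this]
  show ?thesis using assms by metis
qed

text \<open>Homomorphisms are determined by the basis, and extensionality turns agreement on the
  carrier into equality. The identities between automorphisms below are reduced to the basis in this
  way.\<close>

lemma aut_eqI:
  assumes "\<alpha> \<in> carrier A" "\<beta> \<in> carrier A"
    and "\<And>k. k \<in> {1..n} \<Longrightarrow> \<alpha> (free_gen k) = \<beta> (free_gen k)"
  shows "\<alpha> = \<beta>"
proof (rule extensionalityI[of _ "carrier F"])
  show "\<alpha> w = \<beta> w" if "w \<in> carrier F" for w
    by (rule hom_eq_on_gens) (use assms that in \<open>auto simp: aut_carrier\<close>)
qed (use assms in \<open>auto simp: aut_carrier Bij_def\<close>)

lemma free_endo_hom: "f \<in> {1..n} \<rightarrow> carrier F \<Longrightarrow> free_endo n f \<in> hom F F"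
  using word_eval_hom[OF group_free_group, of f n] by (auto simp: free_endo_def hom_def free_mult_closed)

lemma free_endo_gen:
  "f \<in> {1..n} \<rightarrow> carrier F \<Longrightarrow> k \<in> {1..n} \<Longrightarrow> free_endo n f (free_gen k) = f k"
  by (simp add: free_endo_def free_gen_carrier word_eval_gen group_free_group)

text \<open>Both composites of the two endomorphisms fix the basis, so they are mutually
  inverse.\<close>

lemma free_endo_in_aut:
  assumes f: "f \<in> {1..n} \<rightarrow> carrier F" and g: "g \<in> {1..n} \<rightarrow> carrier F"
    and fg: "\<And>k. k \<in> {1..n} \<Longrightarrow> free_endo n f (g k) = free_gen k"
    and gf: "\<And>k. k \<in> {1..n} \<Longrightarrow> free_endo n g (f k) = free_gen k"
  shows "free_endo n f \<in> carrier A"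
proof -
  note homs = free_endo_hom[OF f] free_endo_hom[OF g]
  have id: "(\<lambda>w. w) \<in> hom F F" by (simp add: hom_def)
  have "(free_endo n f \<circ> free_endo n g) w = w" if "w \<in> carrier F" for w
    by (rule hom_eq_on_gens[OF hom_compose[OF homs(2,1)] id _ that])
      (use free_endo_gen[OF g] fg in auto)
  moreover have "(free_endo n g \<circ> free_endo n f) w = w" if "w \<in> carrier F" for w
    by (rule hom_eq_on_gens[OF hom_compose[OF homs(1,2)] id _ that])
      (use free_endo_gen[OF f] gf in auto)
  ultimately have "bij_betw (free_endo n f) (carrier F) (carrier F)"
    using homs by (intro bij_betwI[where g = "free_endo n g"]) (auto simp: hom_def)
  then show ?thesis
    using homs(1) by (simp add: aut_carrier Bij_def free_endo_def)
qed

section \<open>Inversion of one basis element\<close>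

lemma gen_inversion_apply:
  assumes "k \<in> {1..n}"
  shows "gen_inversion n r (free_gen k) = (if k = r then inv\<^bsub>F\<^esub> free_gen k else free_gen k)"
  unfolding gen_inversion_def using assms by (subst free_endo_gen) (auto simp: free_gen_carrier)

lemma gen_inversion_in_aut: "gen_inversion n r \<in> carrier A"
proof -
  let ?f = "\<lambda>k. if k = r then inv\<^bsub>F\<^esub> free_gen k else free_gen k"
  have f: "?f \<in> {1..n} \<rightarrow> carrier F" by (auto simp: free_gen_carrier)
  interpret group_hom F F "gen_inversion n r"
    unfolding gen_inversion_def
    by (simp add: group_hom_def group_hom_axioms_def group_free_group free_endo_hom[OF f])
  have "gen_inversion n r (?f k) = free_gen k" if "k \<in> {1..n}" for k
    using that gen_inversion_apply[OF that, of r] by (auto simp: free_gen_carrier)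
  then show ?thesis
    using free_endo_in_aut[OF f f] by (simp add: gen_inversion_def)
qed

lemma gen_inversion_involution: "gen_inversion n r \<otimes>\<^bsub>A\<^esub> gen_inversion n r = \<one>\<^bsub>A\<^esub>"
proof -
  interpret group_hom F F "gen_inversion n r"
    by (rule aut_group_hom[OF gen_inversion_in_aut])
  show ?thesis
    by (intro aut_eqI)
      (auto simp: aut_one_apply gen_inversion_in_aut aut_mult_apply free_gen_carrier gen_inversion_apply)
qed

section \<open>Shears\<close>

context
  fixes j :: nat
  assumes j: "j \<in> {1..n}"
begin

lemma shear_gens_carrier:
  "(\<lambda>k. if k = j then free_gen j else (free_gen j [^]\<^bsub>F\<^esub> f k) \<otimes>\<^bsub>F\<^esub> free_gen k)
     \<in> {1..n} \<rightarrow> carrier F" for f :: "nat \<Rightarrow> int"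
  using j by (auto simp: free_gen_carrier)

lemma shear_hom: "group_hom F F (shear n j f)"
  unfolding shear_def
  by (simp add: group_hom_def group_hom_axioms_def group_free_group free_endo_hom[OF shear_gens_carrier])

lemma shear_apply:
  assumes "k \<in> {1..n}"
  shows "shear n j f (free_gen k) =
    (if k = j then free_gen j else (free_gen j [^]\<^bsub>F\<^esub> f k) \<otimes>\<^bsub>F\<^esub> free_gen k)"
  unfolding shear_def by (rule free_endo_gen[OF shear_gens_carrier assms])

text \<open>A shear fixes \<open>a_j\<close>, so it passes through powers of \<open>a_j\<close> and
  the exponents add. The claim is confined to the basis because it serves to show that shears are
  automorphisms.\<close>

lemma shear_shear_gen:
  assumes "k \<in> {1..n}"
  shows "shear n j f (shear n j g (free_gen k)) = shear n j (\<lambda>i. f i + g i) (free_gen k)"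
proof -
  interpret group_hom F F "shear n j f" by (rule shear_hom)
  show ?thesis
    using assms j
    by (auto simp: shear_apply free_gen_carrier hom_int_pow F.m_assoc[symmetric] F.int_pow_mult[symmetric] add.commute)
qed

lemma shear_zero_gen: "k \<in> {1..n} \<Longrightarrow> shear n j (\<lambda>i. 0) (free_gen k) = free_gen k"
  using j by (auto simp: shear_apply free_gen_carrier)

text \<open>Negating all exponents gives the inverse.\<close>

lemma shear_in_aut: "shear n j f \<in> carrier A"
proof -
  let ?s = "\<lambda>f k. if k = j then free_gen j else (free_gen j [^]\<^bsub>F\<^esub> (f k :: int)) \<otimes>\<^bsub>F\<^esub> free_gen k"
  have inv: "shear n j g (?s h k) = free_gen k" if "k \<in> {1..n}" "\<And>i. g i + h i = 0" for g h k
    using shear_shear_gen[OF that(1), of g h] shear_zero_gen[OF that(1)]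
    by (simp add: that(2) shear_apply[OF that(1), of h])
  have "shear n j f (?s (\<lambda>i. - f i) k) = free_gen k" "shear n j (\<lambda>i. - f i) (?s f k) = free_gen k"
    if "k \<in> {1..n}" for k
    by (rule inv[OF that], simp)+
  from free_endo_in_aut[OF shear_gens_carrier shear_gens_carrier this[unfolded shear_def]]
  show ?thesis unfolding shear_def .
qed

lemma shear_mult: "shear n j f \<otimes>\<^bsub>A\<^esub> shear n j g = shear n j (\<lambda>i. f i + g i)"
  by (rule aut_eqI) (auto simp: shear_in_aut aut_mult_apply free_gen_carrier shear_shear_gen)

lemma shear_nat_pow: "shear n j f [^]\<^bsub>A\<^esub> m = shear n j (\<lambda>i. int m * f i)"
proof (induction m)
  case 0
  show ?case
    by (intro aut_eqI) (auto simp: aut_one_apply shear_in_aut shear_zero_gen free_gen_carrier)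
next
  case (Suc m)
  then show ?case by (simp add: shear_mult algebra_simps)
qed

lemma transvection_eq_shear: "transvection n i j = shear n j (\<lambda>k. of_bool (k = i))"
  if "i \<in> {1..n}" "i \<noteq> j"
  using that j
  by (intro aut_eqI)
    (auto simp: shear_in_aut transvection_in_aut transvection_hom(2) shear_apply free_gen_carrier)

section \<open>The commutator identity\<close>

text \<open>
  With \<open>\<mu> = \<epsilon> t \<epsilon>\<close>, which sends \<open>a_r\<close> to \<open>a_r a_j^{-f r}\<close> and \<open>a_s\<close> to \<open>a_j^{f s} a_s\<close>, this says
  that the commutator of \<open>\<lambda>_rs\<^sup>-\<^sup>1\<close> and \<open>\<mu>\<close> is \<open>\<lambda>_rj\<close> to the power \<open>f s\<close>.
\<close>

lemma shear_commutator:
  fixes f :: "nat \<Rightarrow> int"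
  assumes r: "r \<in> {1..n}" "r \<noteq> j" and s: "s \<in> {1..n}" "s \<noteq> j" "r \<noteq> s"
  defines "\<mu> \<equiv> gen_inversion n r \<otimes>\<^bsub>A\<^esub> (shear n j f \<otimes>\<^bsub>A\<^esub> gen_inversion n r)"
  shows "transvection n r s \<otimes>\<^bsub>A\<^esub> (shear n j (\<lambda>k. if k = r then f s else 0) \<otimes>\<^bsub>A\<^esub> \<mu>)
    = \<mu> \<otimes>\<^bsub>A\<^esub> transvection n r s"
proof -
  note auts = gen_inversion_in_aut shear_in_aut transvection_in_aut[OF r(1) s(1,3)]
  let ?a = free_gen
  have \<mu>: "\<mu> \<in> carrier A" unfolding \<mu>_def by (intro A.m_closed auts)
  interpret inv: group_hom F F "gen_inversion n r" by (rule aut_group_hom[OF auts(1)])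
  interpret sh: group_hom F F "shear n j g" for g by (rule aut_group_hom[OF auts(2)])
  interpret tv: group_hom F F "transvection n r s" by (rule aut_group_hom[OF auts(3)])
  interpret mu: group_hom F F \<mu> by (rule aut_group_hom[OF \<mu>])
  note gens = free_gen_carrier
  \<comment> \<open>Conjugation by the inversion moves the power of \<open>a_j\<close> to the right
    of \<open>a_r\<close>, out of the way of the \<open>a_s\<close> that \<lambda>_rs puts on the
    left.\<close>
  have mu_apply: "\<mu> (?a k) = (if k = j then ?a k
      else if k = r then ?a r \<otimes>\<^bsub>F\<^esub> inv\<^bsub>F\<^esub> (?a j [^]\<^bsub>F\<^esub> f r)
      else ?a j [^]\<^bsub>F\<^esub> f k \<otimes>\<^bsub>F\<^esub> ?a k)" if "k \<in> {1..n}" for k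
    using that j r s
    by (auto simp: \<mu>_def aut_mult_apply auts gens gen_inversion_apply shear_apply
        inv.hom_int_pow F.inv_mult_group)
  have tv_apply: "transvection n r s (?a k) = (if k = r then ?a s \<otimes>\<^bsub>F\<^esub> ?a r else ?a k)"
    if "k \<in> {1..n}" for k
    using transvection_hom(2)[OF r(1) s(1) that] .
  \<comment> \<open>The decisive basis element is \<open>a_r\<close>: both sides send it to
    \<open>a_j^{f s} a_s a_r a_j^{-f r}\<close>.\<close>
  show ?thesis
    using j r s
    by (intro aut_eqI)
      (auto simp: \<mu> auts gens aut_mult_apply mu_apply tv_apply shear_apply
        tv.hom_int_pow sh.hom_int_pow F.m_assoc)
qed

section \<open>Shears in the kernel of a homomorphism\<close>

context
  fixes G :: "('g, 'b) monoid_scheme" and \<phi> :: "(letter list \<Rightarrow> letter list) \<Rightarrow> 'g"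
  assumes \<phi>: "group_hom A G \<phi>"
begin

interpretation \<phi>: group_hom A G \<phi> by (rule \<phi>)

text \<open>With the shear, its conjugate \<open>?\<mu>\<close> is killed too, so under
  \<open>\<phi>\<close> the commutator identity loses both factors \<open>?\<mu>\<close> and the
  image of \<lambda>_rs cancels.\<close>

lemma kernel_shear_single:
  fixes f :: "nat \<Rightarrow> int"
  assumes "r \<in> {1..n}" "r \<noteq> j" "s \<in> {1..n}" "s \<noteq> j" "r \<noteq> s"
    and f: "\<phi> (shear n j f) = \<one>\<^bsub>G\<^esub>"
  shows "\<phi> (shear n j (\<lambda>k. if k = r then f s else 0)) = \<one>\<^bsub>G\<^esub>"
proof -
  let ?\<mu> = "gen_inversion n r \<otimes>\<^bsub>A\<^esub> (shear n j f \<otimes>\<^bsub>A\<^esub> gen_inversion n r)"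
  let ?x = "shear n j (\<lambda>k. if k = r then f s else 0)"
  note auts = gen_inversion_in_aut shear_in_aut transvection_in_aut[OF assms(1,3,5)]
  have "\<phi> ?\<mu> = \<phi> (gen_inversion n r \<otimes>\<^bsub>A\<^esub> gen_inversion n r)"
    by (simp add: auts f)
  then have \<mu>: "\<phi> ?\<mu> = \<one>\<^bsub>G\<^esub>"
    by (simp only: gen_inversion_involution \<phi>.hom_one)
  have \<mu>_in: "?\<mu> \<in> carrier A" by (intro A.m_closed auts)
  have "\<phi> (transvection n r s) \<otimes>\<^bsub>G\<^esub> \<phi> ?x \<otimes>\<^bsub>G\<^esub> \<phi> ?\<mu> = \<phi> ?\<mu> \<otimes>\<^bsub>G\<^esub> \<phi> (transvection n r s)"
    using arg_cong[OF shear_commutator[OF assms(1-5), of f], of \<phi>] auts \<mu>_in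
    by (simp del: \<phi>.hom_mult add: \<phi>.hom_mult[OF _ A.m_closed] \<phi>.hom_mult[of _ ?\<mu>] \<phi>.hom_mult[of ?\<mu>] \<phi>.H.m_assoc)
  then show ?thesis
    using auts unfolding \<mu> by simp
qed

lemma kernel_transvection_pow:
  fixes f :: "nat \<Rightarrow> int"
  assumes "n \<ge> 3" and s: "s \<in> {1..n}" "s \<noteq> j" and f: "\<phi> (shear n j f) = \<one>\<^bsub>G\<^esub>"
    and i: "i \<in> {1..n}" "i \<noteq> j"
  shows "\<phi> (transvection n i j [^]\<^bsub>A\<^esub> nat \<bar>f s\<bar>) = \<one>\<^bsub>G\<^esub>"
proof -
  have *: "\<phi> (shear n j (\<lambda>k. if k = i then f s else 0)) = \<one>\<^bsub>G\<^esub>"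
  proof (cases "i = s")
    case True
    \<comment> \<open>\<open>kernel_shear_single\<close> only carries an exponent to a different
      index, so getting back to \<open>s\<close> takes a detour through a third index
      \<open>r\<close>.\<close>
    have "\<not> {1..n} \<subseteq> {s, j}"
      using card_mono[of "{s, j}" "{1..n}"] card_insert_le_m1[of 2 "{j}" s] assms(1) by auto
    then obtain r where r: "r \<in> {1..n}" "r \<noteq> s" "r \<noteq> j" by blast
    show ?thesis
      using kernel_shear_single[OF s r(1,3) r(2)[symmetric] kernel_shear_single[OF r(1,3) s r(2) f]] True
      by (simp cong: if_cong)
  qed (rule kernel_shear_single[OF i s _ f])
  have pow: "transvection n i j [^]\<^bsub>A\<^esub> m = shear n j (\<lambda>k. if k = i then int m else 0)" for m
    by (simp add: transvection_eq_shear[OF i] shear_nat_pow of_bool_def if_distrib cong: if_cong)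
  show ?thesis
  proof (cases "f s \<ge> 0")
    case True
    then show ?thesis using * by (simp add: pow cong: if_cong)
  next
    case False
    \<comment> \<open>For negative \<open>f s\<close> the power of \<lambda>_ij is the inverse of
      the killed shear. The unit is written as a zeroth power so that \<open>pow\<close> turns it
      into a shear as well.\<close>
    have "shear n j (\<lambda>k. if k = i then f s else 0) \<otimes>\<^bsub>A\<^esub> transvection n i j [^]\<^bsub>A\<^esub> nat \<bar>f s\<bar>
        = transvection n i j [^]\<^bsub>A\<^esub> (0::nat)"
      using False unfolding pow shear_mult by (intro arg_cong[of _ _ "shear n j"]) auto
    from arg_cong[OF this, of \<phi>] show ?thesis
      using * A.int_pow_closed[OF transvection_in_aut[OF i(1) j i(2)], of "\<bar>f s\<bar>"]
      by (simp add: shear_in_aut)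
  qed
qed

lemma kernel_contains_shear:
  assumes no_free_abelian: "\<nexists>H. subgroup H G \<and> G\<lparr>carrier := H\<rparr> \<cong> free_abelian_power (n - 1)"
  obtains f :: "nat \<Rightarrow> int" and s
  where "s \<in> {1..n}" "s \<noteq> j" "f s \<noteq> 0" "\<phi> (shear n j f) = \<one>\<^bsub>G\<^esub>"
proof -
  let ?Z = "free_abelian_power (n - 1)"
  have "card ({1..n} - {j}) = card {..<n - 1}" using j by simp
  \<comment> \<open>\<open>h\<close> renumbers the indices other than \<open>j\<close> as the
    coordinates of \<open>?Z\<close>.\<close>
  then obtain h where h: "bij_betw h ({1..n} - {j}) {..<n - 1}"
    using bij_betw_iff_card[of "{1..n} - {j}" "{..<n - 1}"] by auto
  define \<theta> where "\<theta> x = shear n j (x \<circ> h)" for x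
  have Z: "group ?Z" by (simp add: free_abelian_power_def)
  \<comment> \<open>The two exponent functions may differ at \<open>j\<close>, where
    \<open>h\<close> is arbitrary; the shears still agree on the basis.\<close>
  have "\<theta> (x \<otimes>\<^bsub>?Z\<^esub> y) = \<theta> x \<otimes>\<^bsub>A\<^esub> \<theta> y" for x y
    unfolding \<theta>_def shear_mult using bij_betwE[OF h] j
    by (intro aut_eqI) (auto simp: shear_in_aut shear_apply free_abelian_power_def)
  then have "\<theta> \<in> hom ?Z A" by (auto simp: hom_def \<theta>_def shear_in_aut)
  then have "\<phi> \<circ> \<theta> \<in> hom ?Z G" using \<phi>.homh by (rule hom_compose)
  then interpret \<phi>\<theta>: group_hom ?Z G "\<phi> \<circ> \<theta>"
    using Z by (simp add: group_hom_def group_hom_axioms_def)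
  have "\<not> inj_on (\<phi> \<circ> \<theta>) (carrier ?Z)"
  proof
    assume "inj_on (\<phi> \<circ> \<theta>) (carrier ?Z)"
    then have "\<phi> \<circ> \<theta> \<in> iso ?Z (G\<lparr>carrier := (\<phi> \<circ> \<theta>) ` carrier ?Z\<rparr>)"
      using \<phi>\<theta>.homh by (auto simp: iso_def hom_def bij_betw_def)
    then have "G\<lparr>carrier := (\<phi> \<circ> \<theta>) ` carrier ?Z\<rparr> \<cong> ?Z"
      using group.iso_sym[OF Z] by (auto simp: is_iso_def)
    then show False using no_free_abelian \<phi>\<theta>.img_is_subgroup by blast
  qed
  then obtain x where x: "x \<in> carrier ?Z" "\<phi> (\<theta> x) = \<one>\<^bsub>G\<^esub>" "x \<noteq> \<one>\<^bsub>?Z\<^esub>"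
    unfolding \<phi>\<theta>.inj_on_one_iff by auto
  \<comment> \<open>Elements of \<open>?Z\<close> are extensional, so one other than the unit has a
    nonzero coordinate.\<close>
  then obtain c where c: "c < n - 1" "x c \<noteq> 0"
    using extensionalityI[of x "{..<n - 1}" "\<one>\<^bsub>?Z\<^esub>"]
    by (auto simp: free_abelian_power_def PiE_def)
  obtain s where "s \<in> {1..n} - {j}" "h s = c"
    using c(1) h by (metis bij_betw_iff_bijections lessThan_iff)
  then show thesis
    using that[of s "x \<circ> h"] c x by (auto simp: \<theta>_def)
qed

end

end

end

section \<open>Factoring through the quotient\<close>

theorem propositionG:
  fixes n :: nat and G :: "('g, 'b) monoid_scheme"
    and \<phi> :: "(letter list \<Rightarrow> letter list) \<Rightarrow> 'g"
  assumes "n \<ge> 3"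
    and "group G"
    and "\<nexists>H. subgroup H G \<and> G\<lparr>carrier := H\<rparr> \<cong> free_abelian_power (n - 1)"
    and "\<phi> \<in> hom (aut_free_group n) G"
  shows "\<exists>m::nat. m \<ge> 1 \<and> (\<exists>\<psi> \<in> hom (Q_group n m) G.
           \<forall>\<alpha> \<in> carrier (aut_free_group n). \<phi> \<alpha> = \<psi> (Q_proj n m \<alpha>))"
proof -
  let ?A = "aut_free_group n"
  interpret \<phi>: group_hom ?A G \<phi>
    using assms(2,4) group_aut_free_group by (simp add: group_hom_def group_hom_axioms_def)
  \<comment> \<open>One exponent serves all \<open>i\<close>, because the absolute value of
    \<open>f s\<close> depends on \<open>j\<close> alone.\<close>
  have "\<exists>m::nat. m \<ge> 1 \<and> (\<forall>i \<in> {1..n} - {j}. \<phi> (transvection n i j [^]\<^bsub>?A\<^esub> m) = \<one>\<^bsub>G\<^esub>)"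
    if j: "j \<in> {1..n}" for j
  proof -
    obtain f :: "nat \<Rightarrow> int" and s
      where fs: "s \<in> {1..n}" "s \<noteq> j" "f s \<noteq> 0" "\<phi> (shear n j f) = \<one>\<^bsub>G\<^esub>"
      using kernel_contains_shear[OF j \<phi>.group_hom_axioms assms(3)] by blast
    then show ?thesis
      using kernel_transvection_pow[OF j \<phi>.group_hom_axioms assms(1) fs(1,2,4)]
      by (intro exI[of _ "nat \<bar>f s\<bar>"]) auto
  qed
  then obtain m :: "nat \<Rightarrow> nat" where m: "\<And>j. j \<in> {1..n} \<Longrightarrow> m j \<ge> 1"
    "\<And>i j. j \<in> {1..n} \<Longrightarrow> i \<in> {1..n} - {j} \<Longrightarrow> \<phi> (transvection n i j [^]\<^bsub>?A\<^esub> m j) = \<one>\<^bsub>G\<^esub>"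
    by metis
  define M where "M = (\<Prod>j = 1..n. m j)"
  have "M \<ge> 1" unfolding M_def using m(1) by (metis prod_ge_1)
  have trans: "\<phi> (transvection n i j [^]\<^bsub>?A\<^esub> M) = \<one>\<^bsub>G\<^esub>"
    if ij: "i \<in> {1..n}" "j \<in> {1..n}" "i \<noteq> j" for i j
  proof -
    have "m j dvd M" unfolding M_def using ij(2) by (intro dvd_prodI) auto
    then obtain q where "M = m j * q" by (auto elim: dvdE)
    then have "transvection n i j [^]\<^bsub>?A\<^esub> M = (transvection n i j [^]\<^bsub>?A\<^esub> m j) [^]\<^bsub>?A\<^esub> q"
      using \<phi>.G.nat_pow_pow[OF transvection_in_aut[OF ij]] by metis
    then show ?thesis
      using m(2)[of j i] ij by (simp add: \<phi>.hom_nat_pow transvection_in_aut)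
  qed
  have "transvection_powers n M \<subseteq> kernel ?A G \<phi>"
    using trans by (auto simp: transvection_powers_def kernel_def intro!: transvection_in_aut)
  \<comment> \<open>The kernel of \<open>\<phi>\<close> is one of the normal subgroups whose
    intersection is the normal closure.\<close>
  then have "transvection_kernel n M \<subseteq> kernel ?A G \<phi>"
    using \<phi>.normal_kernel by (auto simp: transvection_kernel_def normal_closure_def)
  then obtain \<psi> where "\<psi> \<in> hom (Q_group n M) G"
    "\<And>\<alpha>. \<alpha> \<in> carrier ?A \<Longrightarrow> \<psi> (Q_proj n M \<alpha>) = \<phi> \<alpha>"
    using \<phi>.FactGroup_universal_kernel[OF transvection_kernel_normal]
    unfolding Q_group_def Q_proj_def by metis
  then show ?thesis using \<open>M \<ge> 1\<close> by (intro exI[of _ M] conjI bexI[of _ \<psi>]) simp_all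
qed

end
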